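(* Let $k\ge-\tfrac12$, $1<p_1<p_2\le 2$ and $s>0$. If $f\in L_k^{p_1}(\mathbb{R})\cap L_k^{p_2}(\mathbb{R})$, then $$\|f\|_{L_k^{p_1}(\mathbb{R})} \le C(p_1,p_2,k)\, \|f\|_{L_k^{p_2}(\mathbb{R})}^{\frac{p_1p_2s}{(2k+2)(p_2-p_1)+p_1p_2s}}\;\big\||y|^s f\big\|^{\frac{(2k+2)(p_2-p_1)}{(2k+2)(p_2-p_1)+p_1p_2s}}_{L_k^{p_1}(\mathbb{R})},$$ where $$C(p_1,p_2,k) = \left\{ 1+\frac{1}{(2^{k+1}\,\Gamma(k+2))^{\frac{p_2-p_1}{p_2}}}\right\}^{\frac{1}{p_1}}.$$
   Context: For $k\ge-\frac12$ let $d\mu_k(x)=\frac{|x|^{2k+1}}{2^{k+1}\Gamma(k+1)}\,dx$ on $\mathbb{R}$, and let $L^p_k(\mathbb{R})=L^p(\mathbb{R},\mu_k)$ (complex-valued functions) with its usual norm. Norms of functions not in the space are $+\infty$. *)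

theory Defs
  imports "HOL-Analysis.Analysis"
begin

text \<open>
  Elements of \<open>L\<^sup>p\<close> are represented by functions, not by classes modulo null sets.
  The base measure is \<^const>\<open>lebesgue\<close>, so that every Lebesgue measurable representative is covered.
  At \<open>x = 0\<close>, \<open>k = - 1/2\<close> the density is 0 instead of 1, because \<open>0 powr 0 = 0\<close>;
  this changes it on a null set only.
\<close>

definition mu :: "real \<Rightarrow> real measure" where
  "mu k = density lebesgue
     (\<lambda>x. ennreal (\<bar>x\<bar> powr (2 * k + 1) / (2 powr (k + 1) * Gamma (k + 1))))"

definition Lp :: "real \<Rightarrow> 'a measure \<Rightarrow> ('a \<Rightarrow> complex) set" where
  "Lp p M = {f \<in> borel_measurable M. integrable M (\<lambda>x. cmod (f x) powr p)}"

definition Lp_norm :: "real \<Rightarrow> 'a measure \<Rightarrow> ('a \<Rightarrow> complex) \<Rightarrow> ennreal" where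
  "Lp_norm p M f =
     (if f \<in> Lp p M then ennreal ((\<integral>x. cmod (f x) powr p \<partial>M) powr (1 / p)) else \<infinity>)"

text \<open>Real powers of extended nonnegative reals, intended for exponents \<open>a > 0\<close> only.\<close>

definition ennreal_powr :: "ennreal \<Rightarrow> real \<Rightarrow> ennreal" where
  "ennreal_powr x a = (if x = \<infinity> then \<infinity> else ennreal (enn2real x powr a))"

definition C_const :: "real \<Rightarrow> real \<Rightarrow> real \<Rightarrow> real" where
  "C_const p1 p2 k =
     (1 + 1 / (2 powr (k + 1) * Gamma (k + 2)) powr ((p2 - p1) / p2)) powr (1 / p1)"

end

theory Submission
  imports Defs
begin

text \<open>
  Split \<open>\<integral>|f|\<^sup>p\<^sup>1\<close> at \<open>|x| = r\<close>. On the ball, Hoelder's inequality gives a multiple of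
  \<open>A\<^sup>p\<^sup>1 r\<^sup>a\<close> with \<open>A\<close> the \<open>p2\<close>-norm of \<open>f\<close> and \<open>a = (2k + 2)(p2 - p1)/p2\<close>; outside of it,
  \<open>1 \<le> (|x|/r)\<^sup>s\<close> gives \<open>(B / r\<^sup>s)\<^sup>p\<^sup>1\<close> with \<open>B\<close> the \<open>p1\<close>-norm of \<open>|y|\<^sup>s f\<close>.
  The radius at which \<open>A\<^sup>p\<^sup>1 r\<^sup>a = (B / r\<^sup>s)\<^sup>p\<^sup>1\<close> yields the constant.
\<close>

lemma sets_mu: "sets (mu k) = sets lebesgue"
  by (simp add: mu_def)

lemma mu_density_measurable:
  "(\<lambda>x. ennreal (\<bar>x\<bar> powr (2 * k + 1) / (2 powr (k + 1) * Gamma (k + 1)))) \<in> borel_measurable lebesgue"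
proof -
  have "(\<lambda>x. ennreal (\<bar>x\<bar> powr (2 * k + 1) / (2 powr (k + 1) * Gamma (k + 1)))) \<in> borel_measurable lborel"
    by measurable
  then show ?thesis
    by (rule measurable_completion)
qed

text \<open>The density vanishes at 0 for every \<open>k\<close>, since \<open>0 powr a = 0\<close>.
  This lets the weight \<open>\<bar>y\<bar> powr s\<close> be cancelled almost everywhere.\<close>

lemma AE_mu_nonzero: "AE x in mu k. x \<noteq> 0"
  unfolding mu_def by (subst AE_density[OF mu_density_measurable]) (rule AE_I2, auto)

text \<open>Integrate the power over \<open>{0..r}\<close>, where \<open>k > - 1\<close> makes the
  exponent \<open>2 * k + 1\<close> exceed -1, and reflect. The factor \<open>k + 1\<close> from the
  primitive turns \<open>Gamma (k + 1)\<close> into the \<open>Gamma (k + 2)\<close> of the final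
  constant.\<close>

lemma emeasure_mu_interval:
  assumes "k > - 1" "r \<ge> 0"
  shows "emeasure (mu k) {-r..r} = ennreal (r powr (2 * k + 2) / (2 powr (k + 1) * Gamma (k + 2)))"
proof -
  define c where "c = 2 powr (k + 1) * Gamma (k + 1)"
  have c: "c > 0"
    using assms by (simp add: c_def Gamma_real_pos)
  define I where "I = r powr (2 * k + 2) / (2 * k + 2)"
  have half: "((\<lambda>x. \<bar>x\<bar> powr (2 * k + 1)) has_integral I) {0..r}"
  proof (rule has_integral_eq)
    show "((\<lambda>x. x powr (2 * k + 1)) has_integral I) {0..r}"
      using has_integral_powr_from_0[of "2 * k + 1" r] assms by (simp add: I_def add.assoc)
  qed auto
  have "((\<lambda>x. \<bar>x\<bar> powr (2 * k + 1)) has_integral I) {-r..0}"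
    using has_integral_reflect_lemma_real[OF half] by simp
  then have "((\<lambda>x. \<bar>x\<bar> powr (2 * k + 1)) has_integral (I + I)) {-r..r}"
    using half assms by (intro has_integral_combine[of "-r" 0 r]) auto
  then have "((\<lambda>x. \<bar>x\<bar> powr (2 * k + 1) / c) has_integral ((I + I) / c)) {-r..r}"
    by (rule has_integral_divide)
  then have "(\<integral>\<^sup>+x. ennreal (\<bar>x\<bar> powr (2 * k + 1) / c) * indicator {-r..r} x \<partial>lborel) = ennreal ((I + I) / c)"
    using c by (intro nn_integral_has_integral_lebesgue') auto
  moreover have "(I + I) / c = r powr (2 * k + 2) / (2 powr (k + 1) * Gamma (k + 2))"
  proof -
    have "k + 1 \<notin> \<int>\<^sub>\<le>\<^sub>0"
      using assms by (auto simp: nonpos_Ints_def)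
    then have "Gamma (k + 2) = (k + 1) * Gamma (k + 1)"
      using Gamma_plus1[of "k + 1"] by (simp add: add.assoc)
    moreover have "I + I = r powr (2 * k + 2) / (k + 1)"
      using assms by (simp add: I_def divide_simps)
    ultimately show ?thesis
      by (simp add: c_def mult_ac)
  qed
  ultimately show ?thesis
    unfolding mu_def by (simp add: emeasure_density[OF mu_density_measurable] nn_integral_completion c_def)
qed

text \<open>Pointwise weighted Young inequality, with weights \<open>p / q\<close> and
  \<open>1 - p / q\<close>, for \<open>g x powr q\<close> and the indicator of \<open>A\<close>,
  each normalised to integral 1; integrating it gives Hoelder.\<close>

lemma Holder_on_set:
  fixes g :: "'a \<Rightarrow> real"
  assumes A: "A \<in> sets M" "emeasure M A = ennreal V" "V > 0"
    and g: "\<And>x. g x \<ge> 0" "integrable M (\<lambda>x. g x powr q)" "(\<integral>x. g x powr q \<partial>M) > 0"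
    and pq: "0 < p" "p < q"
  shows "(\<integral>x. indicator A x * g x powr p \<partial>M) \<le> (\<integral>x. g x powr q \<partial>M) powr (p / q) * V powr (1 - p / q)"
proof -
  define J where "J = (\<integral>x. g x powr q \<partial>M)"
  define t where "t = p / q"
  have t: "0 < t" "t < 1" and J: "J > 0"
    using pq g by (auto simp: t_def J_def)
  have A': "integrable M (indicator A :: _ \<Rightarrow> real)" "measure M A = V"
    using A by (auto simp: measure_def)
  \<comment> \<open>The Young majorant with the normalisation undone: the weighted mean in the last
    factor has integral t + (1 - t) = 1, so the integral of \<open>h\<close> is exactly the claimed
    bound.\<close>
  define h where "h = (\<lambda>x. J powr t * V powr (1 - t) * (t * (g x powr q / J) + (1 - t) / V * indicator A x))"
  have h: "integrable M h"
    unfolding h_def using g A' by (intro integrable_mult_right integrable_add integrable_divide) auto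
  have "(\<integral>x. h x \<partial>M) = J powr t * V powr (1 - t) * (t * (J / J) + (1 - t) / V * V)"
    unfolding h_def using g A' sets.sets_into_space[OF A(1)] by (simp add: J_def Int_absorb2)
  also have "\<dots> = J powr t * V powr (1 - t)"
    using J A by simp
  finally have h_int: "(\<integral>x. h x \<partial>M) = J powr t * V powr (1 - t)" .
  have nonneg: "0 \<le> h x" for x
    unfolding h_def using t J A by (auto intro!: mult_nonneg_nonneg add_nonneg_nonneg)
  have "indicator A x * g x powr p \<le> h x" for x
  \<comment> \<open>Young's inequality is applied to positive arguments only; in the other case the
    left side is 0.\<close>
  proof (cases "x \<in> A \<and> g x > 0")
    case True
    have "(g x powr q / J) powr t * (1 / V) powr (1 - t) \<le> t * (g x powr q / J) + (1 - t) * (1 / V)"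
      using True t J A by (intro Youngs_inequality_0) auto
    moreover have "(g x powr q / J) powr t * (1 / V) powr (1 - t) = g x powr p / (J powr t * V powr (1 - t))"
      using True J A pq by (simp add: powr_divide powr_powr t_def)
    ultimately have "g x powr p / (J powr t * V powr (1 - t)) \<le> t * (g x powr q / J) + (1 - t) / V"
      by simp
    then have "g x powr p \<le> (t * (g x powr q / J) + (1 - t) / V) * (J powr t * V powr (1 - t))"
      using J A by (simp only: pos_divide_le_eq mult_pos_pos powr_gt_zero)
    then show ?thesis
      using True by (simp add: h_def mult.commute)
  next
    case False
    then show ?thesis
      using nonneg[of x] g(1)[of x] by (cases "x \<in> A") auto
  qed
  \<comment> \<open>\<open>integral_mono'\<close> asks for integrability of the majorant alone. A
    non-integrable left integrand would have integral 0, which \<open>nonneg\<close> covers.\<close>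
  then have "(\<integral>x. indicator A x * g x powr p \<partial>M) \<le> (\<integral>x. h x \<partial>M)"
    by (intro integral_mono'[OF h]) (auto simp: nonneg)
  then show ?thesis
    by (simp add: h_int J_def t_def)
qed

text \<open>The radius is left free here, so that it can afterwards be chosen in terms of the two
  norms.\<close>

lemma Lp_split_bound:
  fixes k p q s r :: real and f :: "real \<Rightarrow> complex"
  assumes k: "k > - 1" and pq: "0 < p" "p < q" and s: "s \<ge> 0" and r: "r > 0"
    and f: "f \<in> Lp p (mu k)" "f \<in> Lp q (mu k)" "(\<integral>x. cmod (f x) powr q \<partial>mu k) > 0"
    and w: "(\<lambda>y. complex_of_real (\<bar>y\<bar> powr s) * f y) \<in> Lp p (mu k)"
  shows "(\<integral>x. cmod (f x) powr p \<partial>mu k)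
    \<le> (\<integral>x. cmod (f x) powr q \<partial>mu k) powr (p / q)
        * (r powr (2 * k + 2) / (2 powr (k + 1) * Gamma (k + 2))) powr (1 - p / q)
      + r powr (- s * p) * (\<integral>x. cmod (complex_of_real (\<bar>x\<bar> powr s) * f x) powr p \<partial>mu k)"
proof -
  let ?A = "{-r..r}"
  let ?V = "r powr (2 * k + 2) / (2 powr (k + 1) * Gamma (k + 2))"
  have A: "?A \<in> sets (mu k)"
    by (simp add: sets_mu)
  have int: "integrable (mu k) (\<lambda>x. cmod (f x) powr p)" "integrable (mu k) (\<lambda>x. cmod (f x) powr q)"
    and int_w: "integrable (mu k) (\<lambda>x. cmod (complex_of_real (\<bar>x\<bar> powr s) * f x) powr p)"
    using f w by (simp_all add: Lp_def)
  have int1: "integrable (mu k) (\<lambda>x. indicator ?A x * cmod (f x) powr p)"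
    using integrable_mult_indicator[OF A int(1)] by simp
  have int2: "integrable (mu k) (\<lambda>x. indicator (- ?A) x * cmod (f x) powr p)"
    using integrable_mult_indicator[OF _ int(1), of "- ?A"] A by (simp add: sets_mu)
  have split: "cmod (f x) powr p = indicator ?A x * cmod (f x) powr p + indicator (- ?A) x * cmod (f x) powr p" for x
    by (simp split: split_indicator)
  have "(\<integral>x. cmod (f x) powr p \<partial>mu k) = (\<integral>x. indicator ?A x * cmod (f x) powr p \<partial>mu k)
      + (\<integral>x. indicator (- ?A) x * cmod (f x) powr p \<partial>mu k)"
    by (subst split, rule Bochner_Integration.integral_add[OF int1 int2])
  also have "(\<integral>x. indicator ?A x * cmod (f x) powr p \<partial>mu k)
      \<le> (\<integral>x. cmod (f x) powr q \<partial>mu k) powr (p / q) * ?V powr (1 - p / q)"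
    using A emeasure_mu_interval[of k r] k r f(3) int(2) pq
    by (intro Holder_on_set[where A = ?A]) (auto intro!: divide_pos_pos mult_pos_pos Gamma_real_pos)
  also have "(\<integral>x. indicator (- ?A) x * cmod (f x) powr p \<partial>mu k)
      \<le> (\<integral>x. r powr (- s * p) * cmod (complex_of_real (\<bar>x\<bar> powr s) * f x) powr p \<partial>mu k)"
  proof (intro integral_mono' integrable_mult_right int_w)
    fix x
    show "indicator (- ?A) x * cmod (f x) powr p
        \<le> r powr (- s * p) * cmod (complex_of_real (\<bar>x\<bar> powr s) * f x) powr p"
    proof (cases "x \<in> ?A")
      case False
      then have "r \<le> \<bar>x\<bar>"
        by auto
      then have "r powr (s * p) \<le> \<bar>x\<bar> powr (s * p)"
        using r s pq by (intro powr_mono2) auto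
      \<comment> \<open>The weight enters with exponent \<open>s * p\<close> because it stands under
        the \<open>p\<close>-th power in the norm.\<close>
      then have "1 \<le> r powr (- s * p) * \<bar>x\<bar> powr (s * p)"
        using r by (simp add: powr_minus field_simps)
      then have "1 * cmod (f x) powr p \<le> r powr (- s * p) * \<bar>x\<bar> powr (s * p) * cmod (f x) powr p"
        by (intro mult_right_mono) auto
      then show ?thesis
        using False by (simp add: norm_mult powr_mult powr_powr mult.assoc)
    qed simp
  qed simp
  finally show ?thesis
    by simp
qed

lemma Lp_null_integral:
  assumes "f \<in> Lp p M" "p \<noteq> 0"
  shows "(\<integral>x. cmod (f x) powr p \<partial>M) = 0 \<longleftrightarrow> (AE x in M. f x = 0)"
  using assms integral_nonneg_eq_0_iff_AE[of M "\<lambda>x. cmod (f x) powr p"]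
  by (simp add: Lp_def)

text \<open>The radius is chosen to make the two summands equal apart from the factor involving
  \<open>D\<close>. Leaving \<open>D\<close> out of the balance is what produces the form 1 + 1 /
  D^((q - p)/q) of the constant.\<close>

lemma balanced_radius_bound:
  fixes A B D k p q s N :: real
  assumes k: "k > - 1" and pq: "0 < p" "p < q" and s: "s > 0" and pos: "A > 0" "B > 0" "D > 0"
    and bound: "\<And>r. r > 0 \<Longrightarrow> N \<le> A powr p * (r powr (2 * k + 2) / D) powr (1 - p / q) + r powr (- s * p) * B powr p"
  defines "E \<equiv> (2 * k + 2) * (q - p) + p * q * s"
  shows "N \<le> (1 + 1 / D powr ((q - p) / q)) * (A powr (p * q * s / E) * B powr ((2 * k + 2) * (q - p) / E)) powr p"
proof -
  \<comment> \<open>In logarithmic coordinates products of powers become exponentials, and comparing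
    them reduces to rational identities between exponents.\<close>
  define \<alpha> \<beta> where "\<alpha> = ln A" and "\<beta> = ln B"
  have AB: "A = exp \<alpha>" "B = exp \<beta>"
    using pos by (auto simp: \<alpha>_def \<beta>_def)
  have E: "E > 0"
    unfolding E_def using k pq s by (intro add_pos_pos) simp_all
  \<comment> \<open>This is r = (B/A)^(pq/E), the solution of A^p r^((2k+2)(q-p)/q) = B^p r^(-sp);
    the powers of r combine to r^(E/q).\<close>
  define r where "r = exp ((\<beta> - \<alpha>) * (p * q) / E)"
  define G where "G = (A powr (p * q * s / E) * B powr ((2 * k + 2) * (q - p) / E)) powr p"
  have G: "G = exp ((\<alpha> * (p * q * s) + \<beta> * ((2 * k + 2) * (q - p))) * p / E)"
  proof -
    have "(\<alpha> * (p * q * s) / E + \<beta> * ((2 * k + 2) * (q - p)) / E) * p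
        = (\<alpha> * (p * q * s) + \<beta> * ((2 * k + 2) * (q - p))) * p / E"
      by (simp only: add_divide_distrib[symmetric] times_divide_eq_left)
    then show ?thesis
      by (simp add: G_def AB exp_powr_real exp_add[symmetric])
  qed
  \<comment> \<open>\<open>e1\<close> and \<open>e2\<close> say that the exponents of the two
    summands, without \<open>D\<close>, both equal that of \<open>G\<close>.\<close>
  have e1: "\<alpha> * p + (\<beta> - \<alpha>) * (p * q) / E * (2 * k + 2) * ((q - p) / q)
      = (\<alpha> * (p * q * s) + \<beta> * ((2 * k + 2) * (q - p))) * p / E"
  proof -
    have "\<alpha> * p = \<alpha> * p * E / E" using E by simp
    then show ?thesis
      using pq E by (simp add: E_def divide_simps) (simp add: algebra_simps)
  qed
  have e2: "(\<beta> - \<alpha>) * (p * q) / E * (- s * p) + \<beta> * p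
      = (\<alpha> * (p * q * s) + \<beta> * ((2 * k + 2) * (q - p))) * p / E"
  proof -
    have "\<beta> * p = \<beta> * p * E / E" using E by simp
    then show ?thesis
      using pq E by (simp add: E_def divide_simps) (simp add: algebra_simps)
  qed
  have pq': "1 - p / q = (q - p) / q"
    using pq by (simp add: field_simps)
  have "A powr p * (r powr (2 * k + 2) / D) powr (1 - p / q)
      = exp (\<alpha> * p + (\<beta> - \<alpha>) * (p * q) / E * (2 * k + 2) * ((q - p) / q)) / D powr ((q - p) / q)"
    using pos(3) by (simp only: pq' powr_divide less_imp_le exp_ge_zero AB r_def exp_powr_real exp_add powr_ge_zero) simp
  moreover have "r powr (- s * p) * B powr p = exp ((\<beta> - \<alpha>) * (p * q) / E * (- s * p) + \<beta> * p)"
    by (simp only: AB r_def exp_powr_real exp_add)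
  ultimately have "N \<le> G / D powr ((q - p) / q) + G"
    using bound[of r] unfolding e1 e2 G[symmetric] by (simp add: r_def)
  then show ?thesis
    by (simp add: G_def algebra_simps)
qed

theorem theorem3p10:
  fixes k p1 p2 s :: real and f :: "real \<Rightarrow> complex"
  assumes "k \<ge> - 1 / 2" and "1 < p1" and "p1 < p2" and "p2 \<le> 2" and "s > 0"
    and "f \<in> Lp p1 (mu k) \<inter> Lp p2 (mu k)"
  shows "Lp_norm p1 (mu k) f
    \<le> ennreal (C_const p1 p2 k)
      * ennreal_powr (Lp_norm p2 (mu k) f)
          (p1 * p2 * s / ((2 * k + 2) * (p2 - p1) + p1 * p2 * s))
      * ennreal_powr (Lp_norm p1 (mu k) (\<lambda>y. complex_of_real (\<bar>y\<bar> powr s) * f y))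
          ((2 * k + 2) * (p2 - p1) / ((2 * k + 2) * (p2 - p1) + p1 * p2 * s))"
proof (cases "AE x in mu k. f x = 0")
  \<comment> \<open>The null function is treated apart because the balancing radius needs both norms
    on the right to be positive.\<close>
  case True
  then have "(\<integral>x. cmod (f x) powr p1 \<partial>mu k) = 0"
    using assms Lp_null_integral[of f p1] by simp
  then show ?thesis
    using assms by (simp add: Lp_norm_def)
next
  case f_nonzero: False
  let ?w = "\<lambda>y. complex_of_real (\<bar>y\<bar> powr s) * f y"
  define J where "J = (\<integral>x. cmod (f x) powr p2 \<partial>mu k)"
  define N where "N = (\<integral>x. cmod (f x) powr p1 \<partial>mu k)"
  define K where "K = (\<integral>x. cmod (?w x) powr p1 \<partial>mu k)"
  define D where "D = 2 powr (k + 1) * Gamma (k + 2)"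
  define E where "E = (2 * k + 2) * (p2 - p1) + p1 * p2 * s"
  define A where "A = J powr (1 / p2)"
  define B where "B = K powr (1 / p1)"
  have f: "f \<in> Lp p1 (mu k)" "f \<in> Lp p2 (mu k)"
    using assms by auto
  have "J \<noteq> 0"
    using f_nonzero assms Lp_null_integral[OF f(2)] by (simp add: J_def)
  then have J: "J > 0"
    by (simp add: J_def less_le)
  then have A: "A > 0"
    by (simp add: A_def)
  have D: "D > 0"
    using assms by (simp add: D_def Gamma_real_pos)
  \<comment> \<open>The constant before the \<open>p1\<close>-th root is taken.\<close>
  define c where "c = 1 + 1 / D powr ((p2 - p1) / p2)"
  have c: "c > 0"
    using D by (simp add: c_def add_pos_pos)
  have C: "C_const p1 p2 k = c powr (1 / p1)"
    by (simp add: C_const_def c_def D_def)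
  have C_pos: "C_const p1 p2 k > 0"
    using c by (simp add: C)
  have norm_f: "Lp_norm p2 (mu k) f = ennreal A" "Lp_norm p1 (mu k) f = ennreal (N powr (1 / p1))"
    using f by (simp_all add: Lp_norm_def A_def J_def N_def)
  show ?thesis
  proof (cases "?w \<in> Lp p1 (mu k)")
    \<comment> \<open>The weighted norm is \<infinity>, and so is the right-hand side: the other two
      factors are positive, which matters because 0 times \<infinity> is 0 in
      \<open>ennreal\<close>.\<close>
    case False
    then show ?thesis
      using C_pos A by (simp add: norm_f Lp_norm_def[of _ _ ?w] ennreal_powr_def ennreal_mult_top ennreal_mult[symmetric])
  next
    case w: True
    \<comment> \<open>Away from 0 the weight is positive, so a null \<open>?w\<close> would force
      \<open>f\<close> to be null.\<close>
    have "\<not> (AE x in mu k. ?w x = 0)"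
    proof
      assume "AE x in mu k. ?w x = 0"
      with AE_mu_nonzero have "AE x in mu k. f x = 0"
        by eventually_elim auto
      with f_nonzero show False ..
    qed
    then have "K \<noteq> 0"
      using assms Lp_null_integral[OF w] by (simp add: K_def)
    then have K: "K > 0"
      by (simp add: K_def less_le)
    then have B: "B > 0"
      by (simp add: B_def)
    have AB: "J powr (p1 / p2) = A powr p1" "K = B powr p1"
      using assms J K by (simp_all add: A_def B_def powr_powr)
    have "N \<le> A powr p1 * (r powr (2 * k + 2) / D) powr (1 - p1 / p2) + r powr (- s * p1) * B powr p1"
      if "r > 0" for r
      using Lp_split_bound[of k p1 p2 s r f] that assms f w J
      by (simp add: AB[symmetric] J_def[symmetric] N_def[symmetric] K_def[symmetric] D_def)
    then have "N \<le> c * (A powr (p1 * p2 * s / E) * B powr ((2 * k + 2) * (p2 - p1) / E)) powr p1"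
      unfolding c_def E_def using assms A B D by (intro balanced_radius_bound) auto
    then have "N powr (1 / p1)
        \<le> (c * (A powr (p1 * p2 * s / E) * B powr ((2 * k + 2) * (p2 - p1) / E)) powr p1) powr (1 / p1)"
      using assms by (intro powr_mono2) (auto simp: N_def)
    also have "\<dots> = C_const p1 p2 k * A powr (p1 * p2 * s / E) * B powr ((2 * k + 2) * (p2 - p1) / E)"
      using assms c A B by (simp add: C powr_mult powr_powr)
    \<comment> \<open>All norms are finite here, so the real inequality carries over to
      \<open>ennreal\<close> factor by factor.\<close>
    finally show ?thesis
      using w A B C_pos
      by (simp add: norm_f Lp_norm_def[of _ _ ?w] ennreal_powr_def K_def[symmetric] B_def[symmetric]
          E_def[symmetric] ennreal_mult[symmetric])
  qed
qed

end
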